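(* Let $\langle\mathcal{X},\mathcal{Y}\rangle$ be an image classification dataset with ground-truth probability law $P$ and finite label set $\mathcal{Y}$, let $Q(y\mid x)$ be a classifier, let $\mathcal{I}=\{\mathcal{I}_0,\dots,\mathcal{I}_{M-1}\}$ be the set of spectral players, let $\bowtie$ be the spectral coalition filtering operator, and let $v$ and $C$ be the characteristic function and the dummy player constant (all defined in the context). Then for every spectral coalition $\widetilde{\mathcal{I}}\subseteq\mathcal{I}$, $$\mathbb{I}(\mathcal{X}\bowtie\widetilde{\mathcal{I}},\,\mathcal{Y}) \;=\; \mathbb{E}_{x\in\mathcal{X}\bowtie\widetilde{\mathcal{I}}}\, D_{KL}\big[P(y\mid x)\,\|\,Q(y\mid x)\big] \;+\; H(\mathcal{Y}) \;+\; v(\widetilde{\mathcal{I}}) \;+\; C,$$ where $\mathbb{I}(\mathcal{X}\bowtie\widetilde{\mathcal{I}},\mathcal{Y})$ is the mutual information between the filtered image and the label, and $H(\mathcal{Y})$ is the Shannon entropy of the label.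
   Context: **Data.** $\langle\mathcal{X},\mathcal{Y}\rangle$ consists of a set $\mathcal{X}$ of images of dimension $H\times W$ (real matrices) and a finite label set $\mathcal{Y}$. $P$ denotes the ground-truth joint law of an image $x$ and its label $y$; $P(x)$ and $P(y)$ are its marginals, and $P(y\mid x)$ is the conditional probability that image $x$ has label $y$. $\mathbb{E}_{x\sim\mathcal{X}}$ is expectation over $x$ with law $P(x)$. **Classifier.** $Q(y\mid x)\in[0,1]$ is a (measurable) conditional probability: for each input image $x$ (original or filtered), $y\mapsto Q(y\mid x)$ is a probability distribution on $\mathcal{Y}$. **Spectral players and coalitions.** The 2D frequency grid $\{0,\dots,H-1\}\times\{0,\dots,W-1\}$ is partitioned into $M$ bands $\mathcal{I}_0,\dots,\mathcal{I}_{M-1}$, called spectral players; $\mathcal{I}=\{\mathcal{I}_i\}_{i=0}^{M-1}$. A subset $\widetilde{\mathcal{I}}\subseteq\mathcal{I}$ is a spectral coalition. **Mask.** $\mathbb{T}(\widetilde{\mathcal{I}})\in\{0,1\}^{H\times W}$ has entry $1$ at the frequency point $(m,n)$ if $(m,n)$ belongs to a band in $\widetilde{\mathcal{I}}$, and $0$ otherwise. **Filtering.** Let $\mathscr{F}$ be the 2D discrete Fourier transform, $\mathscr{F}^{-1}$ its inverse, $\odot$ the entrywise (Hadamard) product, $\mathbf{1}$ the all-ones $H\times W$ matrix, and $\mathbf{b}\in\mathbb{C}^{H\times W}$ a fixed matrix (the absence baseline; in the paper's implementation $\mathbf{b}=0$). For an image $x$, $$x\bowtie\widetilde{\mathcal{I}}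 := \mathscr{F}^{-1}\big[\mathscr{F}(x)\odot\mathbb{T}(\widetilde{\mathcal{I}})+\mathbf{b}\odot(\mathbf{1}-\mathbb{T}(\widetilde{\mathcal{I}}))\big],\qquad \mathcal{X}\bowtie\widetilde{\mathcal{I}}:=\{x\bowtie\widetilde{\mathcal{I}} : x\in\mathcal{X}\}.$$ **Law on filtered images.** The pair (filtered image, label) carries the joint law of $(x\bowtie\widetilde{\mathcal{I}},\,y)$ when $(x,y)$ has law $P$. For $x\in\mathcal{X}\bowtie\widetilde{\mathcal{I}}$, the symbols $P(x)$, $P(x,y)$, $P(y\mid x)$ refer to this law (so $P(y\mid x)$ is the conditional law of the label given the filtered image), and $\mathbb{E}_{x\in\mathcal{X}\bowtie\widetilde{\mathcal{I}}}$ is expectation with respect to its first marginal. **Characteristic function.** $$v(\widetilde{\mathcal{I}}) := \mathbb{E}_{x\sim\mathcal{X}}\sum_{y\in\mathcal{Y}}P(y\mid x)\log Q(y\mid x\bowtie\widetilde{\mathcal{I}})\;-\;C,\qquad C:=\mathbb{E}_{x\sim\mathcal{X}}\sum_{y\in\mathcal{Y}}P(y\mid x)\log Q(y\mid x\bowtie\emptyset),$$ where here $P(y\mid x)$ is the conditional law of the label given the original image $x$. $v$ is real-valued, i.e. these expectations are finite; $v(\emptyset)=0$. **Information quantities.** $D_{KL}[P(y\mid x)\|Q(y\mid x)]=\sum_{y\in\mathcal{Y}}P(y\mid x)\log\frac{P(y\mid x)}{Q(y\mid x)}$ is the point-wise (for fixed $x$) Kullback–Leibler divergence; $H(\mathcal{Y})=-\sum_{y\in\mathcal{Y}}P(y)\log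 P(y)$; $\mathbb{I}$ is the mutual information under the joint law of filtered image and label. Convention $0\log 0=0$. *)

theory Defs
  imports "HOL-Probability.Probability"
begin

text \<open>An \<open>H \<times> W\<close> matrix is a function on \<open>grid H W\<close>, extended by \<open>undefined\<close> outside the grid
  (the encoding of \<^const>\<open>PiM\<close>); matrices carry the Borel sigma-algebra.\<close>

definition grid :: "nat \<Rightarrow> nat \<Rightarrow> (nat \<times> nat) set" where
  "grid H W = {..<H} \<times> {..<W}"

definition real_images :: "nat \<Rightarrow> nat \<Rightarrow> (nat \<times> nat \<Rightarrow> real) measure" where
  "real_images H W = (\<Pi>\<^sub>M k\<in>grid H W. borel)"

definition complex_images :: "nat \<Rightarrow> nat \<Rightarrow> (nat \<times> nat \<Rightarrow> complex) measure" where
  "complex_images H W = (\<Pi>\<^sub>M k\<in>grid H W. borel)"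

definition complexify :: "nat \<Rightarrow> nat \<Rightarrow> (nat \<times> nat \<Rightarrow> real) \<Rightarrow> (nat \<times> nat \<Rightarrow> complex)" where
  "complexify H W x = (\<lambda>k\<in>grid H W. complex_of_real (x k))"

text \<open>The forward transform is unnormalised and the inverse carries the factor \<open>1 / (H W)\<close>.\<close>

definition dft2 :: "nat \<Rightarrow> nat \<Rightarrow> (nat \<times> nat \<Rightarrow> complex) \<Rightarrow> (nat \<times> nat \<Rightarrow> complex)" where
  "dft2 H W x = (\<lambda>(m, n)\<in>grid H W. \<Sum>(h, w)\<in>grid H W.
     x (h, w) * cis (- 2 * pi * (real (m * h) / real H + real (n * w) / real W)))"

definition idft2 :: "nat \<Rightarrow> nat \<Rightarrow> (nat \<times> nat \<Rightarrow> complex) \<Rightarrow> (nat \<times> nat \<Rightarrow> complex)" where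
  "idft2 H W f = (\<lambda>(h, w)\<in>grid H W. (1 / of_nat (H * W)) * (\<Sum>(m, n)\<in>grid H W.
     f (m, n) * cis (2 * pi * (real (m * h) / real H + real (n * w) / real W))))"

definition spectral_players :: "nat \<Rightarrow> (nat \<Rightarrow> (nat \<times> nat) set) \<Rightarrow> (nat \<times> nat) set set" where
  "spectral_players M band = band ` {..<M}"

definition mask :: "(nat \<times> nat) set set \<Rightarrow> nat \<times> nat \<Rightarrow> complex" where
  "mask \<C> k = (if k \<in> \<Union>\<C> then 1 else 0)"

definition coalition_filter ::
  "nat \<Rightarrow> nat \<Rightarrow> (nat \<times> nat \<Rightarrow> complex) \<Rightarrow> (nat \<times> nat) set set
    \<Rightarrow> (nat \<times> nat \<Rightarrow> real) \<Rightarrow> (nat \<times> nat \<Rightarrow> complex)" where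
  "coalition_filter H W b \<C> x = idft2 H W
     (\<lambda>k\<in>grid H W. dft2 H W (complexify H W x) k * mask \<C> k + b k * (1 - mask \<C> k))"

definition filtered_images ::
  "nat \<Rightarrow> nat \<Rightarrow> (nat \<times> nat \<Rightarrow> complex) \<Rightarrow> (nat \<times> nat \<Rightarrow> real) set
    \<Rightarrow> (nat \<times> nat) set set \<Rightarrow> (nat \<times> nat \<Rightarrow> complex) set" where
  "filtered_images H W b X \<C> = coalition_filter H W b \<C> ` X"

text \<open>The inputs of the classifier: the original images, regarded as complex matrices,
  and all filtered ones.\<close>

definition classifier_inputs ::
  "nat \<Rightarrow> nat \<Rightarrow> (nat \<times> nat \<Rightarrow> complex) \<Rightarrow> (nat \<times> nat \<Rightarrow> real) set
    \<Rightarrow> (nat \<times> nat) set set \<Rightarrow> (nat \<times> nat \<Rightarrow> complex) set" where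
  "classifier_inputs H W b X players =
     complexify H W ` X \<union> (\<Union>\<C>\<in>Pow players. filtered_images H W b X \<C>)"

text \<open>Sets of images need not be measurable; they carry the trace of the Borel sigma-algebra.\<close>

definition image_space :: "nat \<Rightarrow> nat \<Rightarrow> (nat \<times> nat \<Rightarrow> real) set \<Rightarrow> (nat \<times> nat \<Rightarrow> real) measure" where
  "image_space H W X = restrict_space (real_images H W) X"

definition filtered_space ::
  "nat \<Rightarrow> nat \<Rightarrow> (nat \<times> nat \<Rightarrow> complex) \<Rightarrow> (nat \<times> nat \<Rightarrow> real) set
    \<Rightarrow> (nat \<times> nat) set set \<Rightarrow> (nat \<times> nat \<Rightarrow> complex) measure" where
  "filtered_space H W b X \<C> = restrict_space (complex_images H W) (filtered_images H W b X \<C>)"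

definition filtered_law ::
  "nat \<Rightarrow> nat \<Rightarrow> (nat \<times> nat \<Rightarrow> complex) \<Rightarrow> (nat \<times> nat \<Rightarrow> real) set \<Rightarrow> 'l set
    \<Rightarrow> ((nat \<times> nat \<Rightarrow> real) \<times> 'l) measure \<Rightarrow> (nat \<times> nat) set set
    \<Rightarrow> ((nat \<times> nat \<Rightarrow> complex) \<times> 'l) measure" where
  "filtered_law H W b X Y P \<C> =
     distr P (filtered_space H W b X \<C> \<Otimes>\<^sub>M count_space Y) (\<lambda>(x, y). (coalition_filter H W b \<C> x, y))"

text \<open>\<open>q y x\<close> stands for \<open>q(y | x)\<close>.\<close>

definition label_kernel :: "'x measure \<Rightarrow> 'l set \<Rightarrow> ('l \<Rightarrow> 'x \<Rightarrow> real) \<Rightarrow> bool" where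
  "label_kernel S Y q \<longleftrightarrow>
     (\<forall>y\<in>Y. q y \<in> borel_measurable S) \<and>
     (\<forall>x\<in>space S. (\<forall>y\<in>Y. 0 \<le> q y x) \<and> (\<Sum>y\<in>Y. q y x) = 1)"

text \<open>\<open>p\<close> is a (regular) version of the conditional law of the label given the image under the
  joint law \<open>J\<close> on \<open>S \<Otimes>\<^sub>M count_space Y\<close>. Conditional laws are unique only up to null sets, so they
  enter as arbitrary versions.\<close>

definition conditional_label_law ::
  "'x measure \<Rightarrow> 'l set \<Rightarrow> ('x \<times> 'l) measure \<Rightarrow> ('l \<Rightarrow> 'x \<Rightarrow> real) \<Rightarrow> bool" where
  "conditional_label_law S Y J p \<longleftrightarrow>
     label_kernel S Y p \<and>
     (\<forall>A\<in>sets S. \<forall>y\<in>Y. emeasure J (A \<times> {y}) = (\<integral>\<^sup>+x\<in>A. ennreal (p y x) \<partial>distr J S fst))"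

text \<open>Logarithms are natural. Since \<^term>\<open>ln (0::real)\<close> is 0 in HOL, expressions in which \<open>Q(y | x)\<close>
  may vanish are extended real valued: \<open>log 0 = - \<infinity>\<close>, and \<open>0 log 0 = 0\<close> because
  \<^prop>\<open>0 * (- \<infinity>) = (0::ereal)\<close>.\<close>

definition elog :: "real \<Rightarrow> ereal" where
  "elog q = (if q = 0 then - \<infinity> else ereal (ln q))"

text \<open>Expectation of the positive part minus expectation of the negative part; in its uses below
  the integrand has constant sign, so \<open>\<infinity> - \<infinity>\<close> does not occur.\<close>

definition ext_expectation :: "'x measure \<Rightarrow> ('x \<Rightarrow> ereal) \<Rightarrow> ereal" where
  "ext_expectation M f =
     enn2ereal (\<integral>\<^sup>+x. e2ennreal (f x) \<partial>M) - enn2ereal (\<integral>\<^sup>+x. e2ennreal (- f x) \<partial>M)"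

text \<open>\<open>P log (P / Q)\<close> with the conventions \<open>0 log (0 / Q) = 0\<close> and \<open>P log (P / 0) = \<infinity>\<close> for \<open>P > 0\<close>.\<close>

definition kl_term :: "real \<Rightarrow> real \<Rightarrow> ereal" where
  "kl_term p q = (if p = 0 then 0 else if q = 0 then \<infinity> else ereal (p * ln (p / q)))"

definition pointwise_KL :: "'l set \<Rightarrow> ('l \<Rightarrow> 'x \<Rightarrow> real) \<Rightarrow> ('l \<Rightarrow> 'x \<Rightarrow> real) \<Rightarrow> 'x \<Rightarrow> ereal" where
  "pointwise_KL Y p q x = (\<Sum>y\<in>Y. kl_term (p y x) (q y x))"

definition label_prob :: "('x \<times> 'l) measure \<Rightarrow> 'l \<Rightarrow> real" where
  "label_prob J y = measure J {z \<in> space J. snd z = y}"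

definition label_entropy :: "'l set \<Rightarrow> ('x \<times> 'l) measure \<Rightarrow> real" where
  "label_entropy Y J = - (\<Sum>y\<in>Y. label_prob J y * ln (label_prob J y))"

definition label_mutual_information :: "'x measure \<Rightarrow> 'l set \<Rightarrow> ('x \<times> 'l) measure \<Rightarrow> real" where
  "label_mutual_information S Y J =
     prob_space.mutual_information J (exp 1) S (count_space Y) fst snd"

text \<open>\<open>E\<^sub>x \<Sum>\<^sub>y P(y | x) log Q(y | x \<bowtie> \<C>)\<close>, where \<open>p\<close> is the conditional label law given the original
  image.\<close>

definition expected_log_likelihood ::
  "nat \<Rightarrow> nat \<Rightarrow> (nat \<times> nat \<Rightarrow> complex) \<Rightarrow> (nat \<times> nat \<Rightarrow> real) set \<Rightarrow> 'l set
    \<Rightarrow> ((nat \<times> nat \<Rightarrow> real) \<times> 'l) measure \<Rightarrow> ('l \<Rightarrow> (nat \<times> nat \<Rightarrow> real) \<Rightarrow> real)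
    \<Rightarrow> ('l \<Rightarrow> (nat \<times> nat \<Rightarrow> complex) \<Rightarrow> real) \<Rightarrow> (nat \<times> nat) set set \<Rightarrow> ereal" where
  "expected_log_likelihood H W b X Y P p Q \<C> =
     ext_expectation (distr P (image_space H W X) fst)
       (\<lambda>x. \<Sum>y\<in>Y. ereal (p y x) * elog (Q y (coalition_filter H W b \<C> x)))"

definition dummy_constant ::
  "nat \<Rightarrow> nat \<Rightarrow> (nat \<times> nat \<Rightarrow> complex) \<Rightarrow> (nat \<times> nat \<Rightarrow> real) set \<Rightarrow> 'l set
    \<Rightarrow> ((nat \<times> nat \<Rightarrow> real) \<times> 'l) measure \<Rightarrow> ('l \<Rightarrow> (nat \<times> nat \<Rightarrow> real) \<Rightarrow> real)
    \<Rightarrow> ('l \<Rightarrow> (nat \<times> nat \<Rightarrow> complex) \<Rightarrow> real) \<Rightarrow> ereal" where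
  "dummy_constant H W b X Y P p Q = expected_log_likelihood H W b X Y P p Q {}"

definition characteristic_function ::
  "nat \<Rightarrow> nat \<Rightarrow> (nat \<times> nat \<Rightarrow> complex) \<Rightarrow> (nat \<times> nat \<Rightarrow> real) set \<Rightarrow> 'l set
    \<Rightarrow> ((nat \<times> nat \<Rightarrow> real) \<times> 'l) measure \<Rightarrow> ('l \<Rightarrow> (nat \<times> nat \<Rightarrow> real) \<Rightarrow> real)
    \<Rightarrow> ('l \<Rightarrow> (nat \<times> nat \<Rightarrow> complex) \<Rightarrow> real) \<Rightarrow> (nat \<times> nat) set set \<Rightarrow> ereal" where
  "characteristic_function H W b X Y P p Q \<C> =
     expected_log_likelihood H W b X Y P p Q \<C> - dummy_constant H W b X Y P p Q"

end

theory Submission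
  imports Defs
begin

text \<open>Let \<open>N\<close> be the law of the filtered image \<open>x'\<close>, \<open>p\<^sub>f\<close> the conditional label law given \<open>x'\<close> and \<open>\<pi>\<close>
  the label marginal. The joint law has density \<open>p\<^sub>f(y | x')\<close> and the product of the marginals has
  density \<open>\<pi>(y)\<close> with respect to \<open>N\<close> times counting measure, so the mutual information is
  \<open>E \<Sum>\<^sub>y p\<^sub>f ln p\<^sub>f + H\<close>. Pointwise, \<open>\<Sum>\<^sub>y p\<^sub>f ln p\<^sub>f\<close> is the divergence plus
  \<open>\<Sum>\<^sub>y p\<^sub>f ln Q\<close>. By the change of variables \<open>(x, y) \<mapsto> (x \<bowtie> \<C>, y)\<close> the expectation of the
  latter is \<open>v(\<C>) + C\<close>, although \<open>v\<close> is defined with the conditional law given the original image: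
  both are the integral of \<open>ln Q(y | x \<bowtie> \<C>)\<close> against the joint law.\<close>

section \<open>Label kernels, elementary bounds and extended logarithms\<close>

lemma label_kernel_le_1:
  assumes "finite Y" "label_kernel S Y q" "x \<in> space S" "y \<in> Y"
  shows "q y x \<le> 1"
proof -
  have "q y x \<le> (\<Sum>y\<in>Y. q y x)"
    using assms by (intro member_le_sum) (auto simp: label_kernel_def)
  then show ?thesis
    using assms by (simp add: label_kernel_def)
qed

text \<open>The label takes countably many values, so measurability can be tested label by
  label.\<close>

lemma measurable_pair_count_space:
  assumes "countable Y" and g: "\<And>y. y \<in> Y \<Longrightarrow> g y \<in> measurable S N"
  shows "(\<lambda>(x, y). g y x) \<in> measurable (S \<Otimes>\<^sub>M count_space Y) N"
proof -
  have "(\<lambda>z. g (snd z) (fst z)) \<in> measurable (S \<Otimes>\<^sub>M count_space Y) N"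
    by (rule measurable_compose_countable'[where f="\<lambda>y z. g y (fst z)" and g=snd and I=Y])
      (use assms in \<open>auto intro: measurable_compose[OF measurable_fst]\<close>)
  then show ?thesis
    by (simp add: case_prod_beta')
qed

text \<open>The default value \<open>ln 0 = 0\<close> covers \<open>t = 0\<close>.\<close>

lemma ln_nonpos_if_le_1: "0 \<le> t \<Longrightarrow> t \<le> 1 \<Longrightarrow> ln t \<le> (0::real)"
  by (cases "t = 0") auto

text \<open>Follows from \<open>ln s \<le> s - 1\<close> at \<open>s = 1 / t\<close>. This crude
  uniform bound makes all entropy integrands integrable over a probability measure.\<close>

lemma abs_mult_ln_le_1:
  fixes t :: real
  assumes "0 \<le> t" "t \<le> 1"
  shows "\<bar>t * ln t\<bar> \<le> 1"
proof (cases "t = 0")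
  case False
  then have t: "0 < t" using assms by simp
  have "- ln t = ln (1 / t)" using t by (simp add: ln_div)
  also have "\<dots> \<le> 1 / t - 1" using t by (intro ln_le_minus_one) simp
  finally have "t * (- ln t) \<le> t * (1 / t - 1)" using t by (intro mult_left_mono) auto
  also have "\<dots> \<le> 1" using t by (simp add: field_simps)
  finally have "- 1 \<le> t * ln t" by simp
  moreover have "t * ln t \<le> 0" using assms by (intro mult_nonneg_nonpos ln_nonpos_if_le_1)
  ultimately show ?thesis by simp
qed simp

text \<open>The sign condition keeps opposite infinities from meeting; without it, negation need not
  distribute over sums in \<open>ereal\<close>.\<close>

lemma sum_uminus_ereal:
  fixes f :: "'a \<Rightarrow> ereal"
  assumes "\<And>i. i \<in> A \<Longrightarrow> 0 \<le> f i"
  shows "(\<Sum>i\<in>A. - f i) = - (\<Sum>i\<in>A. f i)"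
  using assms
proof (induction A rule: infinite_finite_induct)
  case (insert i A)
  have "0 \<le> f i" "0 \<le> sum f A"
    using insert.prems by (auto intro: sum_nonneg)
  then have "- f i + - sum f A = - (f i + sum f A)"
    by (cases "f i"; cases "sum f A") auto
  then show ?case using insert by simp
qed simp_all

lemma elog_measurable [measurable]: "elog \<in> borel_measurable borel"
  unfolding elog_def by measurable

lemma elog_nonpos: "0 \<le> q \<Longrightarrow> q \<le> 1 \<Longrightarrow> elog q \<le> 0"
  by (auto simp: elog_def)

text \<open>Moves a log-likelihood term into \<open>ennreal\<close>, where the nonnegative integral
  is available; the convention \<open>0 * \<infinity> = 0\<close> agrees in both types.\<close>

lemma neg_mult_elog:
  assumes "0 \<le> t" "0 \<le> q" "q \<le> 1"
  shows "ereal t * elog q = - enn2ereal (ennreal t * e2ennreal (- elog q))"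
proof -
  have "0 \<le> - elog q"
    using elog_nonpos[OF assms(2,3)] by simp
  then show ?thesis
    using assms(1) by (simp add: times_ennreal.rep_eq enn2ereal_e2ennreal)
qed

text \<open>Both sides are \<open>\<infinity>\<close> if \<open>q = 0 < t\<close>, and 0 if \<open>t = 0\<close>.\<close>

lemma kl_term_eq:
  assumes "0 \<le> t" "0 \<le> q" "q \<le> 1"
  shows "kl_term t q = ereal (t * ln t) + enn2ereal (ennreal t * e2ennreal (- elog q))"
proof -
  have "kl_term t q = ereal (t * ln t) - ereal t * elog q"
    using assms by (auto simp: kl_term_def elog_def ln_div right_diff_distrib)
  then show ?thesis
    by (simp add: neg_mult_elog[OF assms] minus_ereal_def)
qed

text \<open>Single terms of the divergence may be negative. This lower bound, from
  \<open>ln s \<le> s - 1\<close> at \<open>s = q / t\<close>, is chosen because it cancels upon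
  summation over the labels.\<close>

lemma kl_term_ge_diff:
  assumes "0 \<le> t" "0 \<le> q"
  shows "ereal (t - q) \<le> kl_term t q"
proof (cases "t = 0 \<or> q = 0")
  case True
  then show ?thesis using assms by (auto simp: kl_term_def)
next
  case False
  then have "0 < t" "0 < q" using assms by auto
  then have "t * ln (q / t) \<le> t * (q / t - 1)"
    by (intro mult_left_mono ln_le_minus_one) auto
  also have "\<dots> = q - t"
    using \<open>0 < t\<close> by (simp add: right_diff_distrib)
  finally have "t - q \<le> t * ln (t / q)"
    using \<open>0 < t\<close> \<open>0 < q\<close> by (simp add: ln_div right_diff_distrib)
  then show ?thesis using False by (simp add: kl_term_def)
qed

text \<open>Gibbs' inequality: the termwise lower bounds \<open>p y x - q y x\<close> add up to 0,
  both kernels having total mass 1.\<close>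

lemma pointwise_KL_nonneg:
  assumes "label_kernel S Y p" "label_kernel S Y q" "x \<in> space S"
  shows "0 \<le> pointwise_KL Y p q x"
proof -
  have "0 = ereal (\<Sum>y\<in>Y. p y x - q y x)"
    using assms by (simp add: sum_subtractf label_kernel_def)
  also have "\<dots> = (\<Sum>y\<in>Y. ereal (p y x - q y x))"
    by (simp add: sum_ereal)
  also have "\<dots> \<le> pointwise_KL Y p q x"
    unfolding pointwise_KL_def using assms
    by (intro sum_mono kl_term_ge_diff) (auto simp: label_kernel_def)
  finally show ?thesis .
qed

text \<open>Divergence is negative entropy plus cross entropy. Only the second summand can be
  infinite, and it is nonnegative, so the sum is well defined.\<close>

lemma pointwise_KL_eq:
  assumes "finite Y" "label_kernel S Y p" "label_kernel S Y q" "x \<in> space S"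
  shows "pointwise_KL Y p q x = ereal (\<Sum>y\<in>Y. p y x * ln (p y x)) +
    enn2ereal (\<Sum>y\<in>Y. ennreal (p y x) * e2ennreal (- elog (q y x)))"
proof -
  have "pointwise_KL Y p q x = (\<Sum>y\<in>Y. ereal (p y x * ln (p y x)) +
      enn2ereal (ennreal (p y x) * e2ennreal (- elog (q y x))))"
    unfolding pointwise_KL_def using assms label_kernel_le_1[OF assms(1,3,4)]
    by (intro sum.cong kl_term_eq) (auto simp: label_kernel_def)
  then show ?thesis
    by (simp add: sum.distrib sum_ereal)
qed

section \<open>Joint laws of an image and a label\<close>

text \<open>The image space is abstract because the setting is instantiated twice: for original
  images under \<open>P\<close> and for filtered images under the pushforward law.\<close>

locale conditional_labels = J: prob_space J
  for S :: "'x measure" and Y :: "'l set" and J :: "('x \<times> 'l) measure" and p :: "'l \<Rightarrow> 'x \<Rightarrow> real" +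
  assumes finite_Y: "finite Y"
    and sets_J [measurable_cong]: "sets J = sets (S \<Otimes>\<^sub>M count_space Y)"
    and law: "conditional_label_law S Y J p"
begin

abbreviation N :: "'x measure" where "N \<equiv> distr J S fst"

abbreviation \<pi> :: "'l \<Rightarrow> real" where "\<pi> \<equiv> label_prob J"

abbreviation p_ln_p :: "'x \<Rightarrow> real" where "p_ln_p x \<equiv> (\<Sum>y\<in>Y. p y x * ln (p y x))"

lemma space_J: "space J = space S \<times> Y"
  using sets_eq_imp_space_eq[OF sets_J] by (simp add: space_pair_measure)

lemma kernel: "label_kernel S Y p"
  using law by (simp add: conditional_label_law_def)

lemma p_measurable [measurable (raw)]: "y \<in> Y \<Longrightarrow> p y \<in> borel_measurable S"
  using kernel by (simp add: label_kernel_def)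

lemma p_nonneg: "x \<in> space S \<Longrightarrow> y \<in> Y \<Longrightarrow> 0 \<le> p y x"
  using kernel by (simp add: label_kernel_def)

lemma p_le_1: "x \<in> space S \<Longrightarrow> y \<in> Y \<Longrightarrow> p y x \<le> 1"
  by (rule label_kernel_le_1[OF finite_Y kernel])

lemma emeasure_J_Times:
  "A \<in> sets S \<Longrightarrow> y \<in> Y \<Longrightarrow> emeasure J (A \<times> {y}) = (\<integral>\<^sup>+x\<in>A. ennreal (p y x) \<partial>N)"
  using law by (simp add: conditional_label_law_def)

lemma fst_measurable_J [measurable]: "fst \<in> measurable J S"
  using measurable_fst by (simp add: measurable_cong_sets[OF sets_J refl])

lemma snd_measurable_J [measurable]: "snd \<in> measurable J (count_space Y)"
  using measurable_snd by (simp add: measurable_cong_sets[OF sets_J refl])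

sublocale N: prob_space N
  by (rule J.prob_space_distr) simp

sublocale count: finite_measure "count_space Y"
  by (rule finite_measure_count_space[OF finite_Y])

sublocale NY: pair_sigma_finite N "count_space Y" ..

lemma sets_NY: "sets (N \<Otimes>\<^sub>M count_space Y) = sets J"
  unfolding sets_J by (rule sets_pair_measure_cong) simp_all

lemma pair_measurable:
  assumes "\<And>y. y \<in> Y \<Longrightarrow> g y \<in> measurable S M"
  shows "(\<lambda>(x, y). g y x) \<in> measurable (N \<Otimes>\<^sub>M count_space Y) M"
  using measurable_pair_count_space[OF countable_finite[OF finite_Y] assms]
  by (simp add: measurable_cong_sets[OF sets_NY refl] measurable_cong_sets[OF sets_J refl])

lemma nn_integral_pair:
  assumes "\<And>y. y \<in> Y \<Longrightarrow> g y \<in> borel_measurable S"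
  shows "(\<integral>\<^sup>+(x, y). g y x \<partial>(N \<Otimes>\<^sub>M count_space Y)) = (\<integral>\<^sup>+x. (\<Sum>y\<in>Y. g y x) \<partial>N)"
  using count.nn_integral_fst[OF pair_measurable[OF assms]]
  by (simp add: nn_integral_count_space_finite[OF finite_Y])

text \<open>The conditional law prescribes \<open>J\<close> on the rectangles
  \<open>A \<times> {y}\<close> only. Since \<open>Y\<close> is finite, every measurable set is a
  finite disjoint union of such rectangles, built from its sections \<open>D y\<close>.\<close>

lemma J_eq_density: "J = density (N \<Otimes>\<^sub>M count_space Y) (\<lambda>(x, y). ennreal (p y x))"
proof (rule measure_eqI)
  show "sets J = sets (density (N \<Otimes>\<^sub>M count_space Y) (\<lambda>(x, y). ennreal (p y x)))"
    by (simp add: sets_NY)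
  fix E assume E: "E \<in> sets J"
  define D where "D y = (\<lambda>x. (x, y)) -` E" for y
  have D [measurable]: "D y \<in> sets S" for y
    using E unfolding sets_J D_def by (rule sets_Pair2)
  have E_eq: "E = (\<Union>y\<in>Y. D y \<times> {y})"
    using sets.sets_into_space[OF E] by (auto simp: D_def space_J)
  have slice: "D y \<times> {y} \<in> sets J" if "y \<in> Y" for y
    using D that by (simp add: sets_J)
  have "emeasure J E = (\<Sum>y\<in>Y. emeasure J (D y \<times> {y}))"
    by (subst E_eq, rule sum_emeasure[symmetric])
      (use finite_Y slice in \<open>auto simp: disjoint_family_on_def\<close>)
  also have "\<dots> = (\<Sum>y\<in>Y. \<integral>\<^sup>+x. ennreal (p y x) * indicator (D y) x \<partial>N)"
    using D by (simp add: emeasure_J_Times)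
  also have "\<dots> = (\<integral>\<^sup>+x. (\<Sum>y\<in>Y. ennreal (p y x) * indicator (D y) x) \<partial>N)"
    by (intro nn_integral_sum[symmetric]) measurable
  also have "\<dots> = (\<integral>\<^sup>+(x, y). ennreal (p y x) * indicator (D y) x \<partial>(N \<Otimes>\<^sub>M count_space Y))"
    by (intro nn_integral_pair[symmetric]) measurable
  also have "\<dots> = (\<integral>\<^sup>+z. (\<lambda>(x, y). ennreal (p y x)) z * indicator E z \<partial>(N \<Otimes>\<^sub>M count_space Y))"
    by (intro nn_integral_cong) (auto simp: D_def indicator_def)
  also have "\<dots> = emeasure (density (N \<Otimes>\<^sub>M count_space Y) (\<lambda>(x, y). ennreal (p y x))) E"
    using E by (intro emeasure_density[symmetric] pair_measurable)
      (simp_all add: sets_NY)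
  finally show "emeasure J E = \<dots>" .
qed

text \<open>Disintegration of the joint law: the bridge between integrals over pairs and
  expectations of conditional sums.\<close>

lemma nn_integral_J:
  assumes g: "\<And>y. y \<in> Y \<Longrightarrow> g y \<in> borel_measurable S"
  shows "(\<integral>\<^sup>+(x, y). g y x \<partial>J) = (\<integral>\<^sup>+x. (\<Sum>y\<in>Y. ennreal (p y x) * g y x) \<partial>N)"
proof -
  have "(\<integral>\<^sup>+(x, y). g y x \<partial>J) =
      (\<integral>\<^sup>+z. (\<lambda>(x, y). ennreal (p y x)) z * (\<lambda>(x, y). g y x) z \<partial>(N \<Otimes>\<^sub>M count_space Y))"
    by (subst J_eq_density, rule nn_integral_density) (use g in \<open>auto intro!: pair_measurable\<close>)
  also have "\<dots> = (\<integral>\<^sup>+(x, y). ennreal (p y x) * g y x \<partial>(N \<Otimes>\<^sub>M count_space Y))"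
    by (simp add: case_prod_beta')
  also have "\<dots> = (\<integral>\<^sup>+x. (\<Sum>y\<in>Y. ennreal (p y x) * g y x) \<partial>N)"
    using g by (intro nn_integral_pair) measurable
  finally show ?thesis .
qed

lemma label_prob_eq:
  assumes "y \<in> Y"
  shows "ennreal (\<pi> y) = emeasure J (space S \<times> {y})"
proof -
  have "{z \<in> space J. snd z = y} = space S \<times> {y}"
    using assms by (auto simp: space_J)
  then show ?thesis
    by (simp add: label_prob_def J.emeasure_eq_measure)
qed

lemma label_prob_nonneg: "0 \<le> \<pi> y"
  by (simp add: label_prob_def)

lemma nn_integral_p: "y \<in> Y \<Longrightarrow> (\<integral>\<^sup>+x. ennreal (p y x) \<partial>N) = ennreal (\<pi> y)"
  by (simp add: label_prob_eq emeasure_J_Times)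
     (auto intro!: nn_integral_cong simp: indicator_def)

lemma integrable_p: "y \<in> Y \<Longrightarrow> integrable N (p y)"
  by (rule N.integrable_const_bound[where B=1]) (auto simp: p_nonneg p_le_1)

lemma integral_p: "y \<in> Y \<Longrightarrow> (\<integral>x. p y x \<partial>N) = \<pi> y"
  by (subst integral_eq_nn_integral)
     (auto simp: p_nonneg nn_integral_p label_prob_nonneg)

text \<open>A nonnegative function with integral 0 vanishes almost everywhere. This is the absolute
  continuity of the joint law with respect to the product of its marginals.\<close>

lemma p_eq_0_AE:
  assumes "y \<in> Y" "\<pi> y = 0"
  shows "AE x in N. p y x = 0"
proof -
  have "AE x in N. ennreal (p y x) = 0"
    using assms by (subst nn_integral_0_iff_AE[symmetric]) (auto simp: nn_integral_p)
  then show ?thesis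
    by (rule AE_mp) (use assms in \<open>auto intro!: AE_I2 antisym simp: ennreal_eq_0_iff p_nonneg\<close>)
qed

lemma distr_snd: "distr J (count_space Y) snd = density (count_space Y) (\<lambda>y. ennreal (\<pi> y))"
proof (rule measure_eqI_finite[where A=Y])
  fix y assume y: "y \<in> Y"
  have "snd -` {y} \<inter> space J = space S \<times> {y}"
    using y by (auto simp: space_J)
  then show "emeasure (distr J (count_space Y) snd) {y} =
      emeasure (density (count_space Y) (\<lambda>y. ennreal (\<pi> y))) {y}"
    using y finite_Y
    by (simp add: emeasure_distr emeasure_density label_prob_eq nn_integral_count_space_finite
        indicator_def if_distrib cong: if_cong)
qed (simp_all add: finite_Y)

text \<open>Gives the product the same reference measure as in \<open>J_eq_density\<close>, so that
  the mutual information compares two densities.\<close>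

lemma product_of_marginals:
  "N \<Otimes>\<^sub>M distr J (count_space Y) snd =
     density (N \<Otimes>\<^sub>M count_space Y) (\<lambda>(x, y). ennreal (\<pi> y))"
proof -
  \<comment> \<open>The constant density 1 brings \<open>N\<close> into the form expected by
    \<open>pair_measure_density\<close>.\<close>
  have "density N (\<lambda>x. 1) \<Otimes>\<^sub>M density (count_space Y) (\<lambda>y. ennreal (\<pi> y)) =
      density (N \<Otimes>\<^sub>M count_space Y) (\<lambda>(x, y). 1 * ennreal (\<pi> y))"
  proof (rule pair_measure_density)
    have "prob_space (density (count_space Y) (\<lambda>y. ennreal (\<pi> y)))"
      unfolding distr_snd[symmetric] by (rule J.prob_space_distr) simp
    then interpret D: prob_space "density (count_space Y) (\<lambda>y. ennreal (\<pi> y))" .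
    show "sigma_finite_measure (density (count_space Y) (\<lambda>y. ennreal (\<pi> y)))" ..
    show "sigma_finite_measure (count_space Y)" ..
  qed simp_all
  then show ?thesis
    by (simp add: density_1 distr_snd)
qed

lemma integrable_p_ln_p: "y \<in> Y \<Longrightarrow> integrable N (\<lambda>x. p y x * ln (p y x))"
  by (rule N.integrable_const_bound[where B=1])
     (auto intro!: AE_I2 abs_mult_ln_le_1 simp: p_nonneg p_le_1)

text \<open>The logarithm of the density ratio splits into \<open>ln p\<close> and
  \<open>ln \<pi>\<close>; averaging \<open>p y\<close> over the images gives
  \<open>\<pi> y\<close>, which turns the second part into the label entropy.\<close>

lemma mutual_information_eq:
  "label_mutual_information S Y J = (\<integral>x. p_ln_p x \<partial>N) + label_entropy Y J"
proof -
  interpret NY': finite_measure "N \<Otimes>\<^sub>M count_space Y"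
    by (rule finite_measure_pair_measure) unfold_locales
  \<comment> \<open>Where \<open>\<pi> y = 0\<close>, the defaults \<open>t / 0 = 0\<close> and
    \<open>ln 0 = 0\<close> make \<open>g y x\<close> equal to 0.\<close>
  define g where "g y x = p y x * ln (p y x / \<pi> y)" for y x
  have g_meas [measurable (raw)]: "g y \<in> borel_measurable S" if "y \<in> Y" for y
    unfolding g_def using that by measurable
  \<comment> \<open>Only almost everywhere: if \<open>\<pi> y = 0\<close>, the identity fails where
    \<open>0 < p y x < 1\<close>, a null set by \<open>p_eq_0_AE\<close>.\<close>
  have g_AE: "AE x in N. g y x = p y x * ln (p y x) - p y x * ln (\<pi> y)" if y: "y \<in> Y" for y
  proof (cases "\<pi> y = 0")
    case True
    show ?thesis
      using p_eq_0_AE[OF y True] by (rule AE_mp) (auto simp: g_def)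
  next
    case False
    then have "0 < \<pi> y" using label_prob_nonneg[of y] by simp
    have "p y x * ln (p y x / \<pi> y) = p y x * ln (p y x) - p y x * ln (\<pi> y)"
      if "x \<in> space S" for x
      using p_nonneg[OF that y] \<open>0 < \<pi> y\<close>
      by (cases "p y x = 0") (auto simp: ln_div right_diff_distrib)
    then show ?thesis
      by (auto intro!: AE_I2 simp: g_def)
  qed
  \<comment> \<open>Summing over all labels makes the bound uniform in \<open>y\<close>, so
    \<open>g\<close> is integrable over the finite product measure and Fubini applies.\<close>
  have g_bound: "\<bar>g y x\<bar> \<le> 1 + (\<Sum>y\<in>Y. \<bar>ln (\<pi> y)\<bar>)" if x: "x \<in> space S" and y: "y \<in> Y" for x y
  proof (cases "p y x = 0 \<or> \<pi> y = 0")
    case True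
    then show ?thesis by (auto simp: g_def intro!: add_nonneg_nonneg sum_nonneg)
  next
    case False
    then have "0 < \<pi> y" "0 < p y x"
      using label_prob_nonneg[of y] p_nonneg[OF x y] by auto
    then have "g y x = p y x * ln (p y x) - p y x * ln (\<pi> y)"
      by (simp add: g_def ln_div right_diff_distrib)
    moreover have "\<bar>p y x * ln (p y x)\<bar> \<le> 1"
      using x y by (intro abs_mult_ln_le_1 p_nonneg p_le_1)
    moreover have "\<bar>p y x * ln (\<pi> y)\<bar> \<le> 1 * \<bar>ln (\<pi> y)\<bar>"
      unfolding abs_mult using x y by (intro mult_right_mono) (auto simp: p_nonneg p_le_1)
    moreover have "\<bar>ln (\<pi> y)\<bar> \<le> (\<Sum>y\<in>Y. \<bar>ln (\<pi> y)\<bar>)"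
      using y finite_Y by (intro member_le_sum) auto
    ultimately show ?thesis by linarith
  qed
  have ac: "AE z in N \<Otimes>\<^sub>M count_space Y. (\<lambda>(x, y). \<pi> y) z = 0 \<longrightarrow> (\<lambda>(x, y). p y x) z = 0"
  proof (rule NY.AE_pair_measure)
    have "Measurable.pred (N \<Otimes>\<^sub>M count_space Y) (\<lambda>(x, y). \<pi> y = 0 \<longrightarrow> p y x = 0)"
      by (rule pair_measurable[where g="\<lambda>y x. \<pi> y = 0 \<longrightarrow> p y x = 0"]) measurable
    then show "{z \<in> space (N \<Otimes>\<^sub>M count_space Y).
        (\<lambda>(x, y). \<pi> y) z = 0 \<longrightarrow> (\<lambda>(x, y). p y x) z = 0} \<in> sets (N \<Otimes>\<^sub>M count_space Y)"
      by (simp only: pred_def case_prod_beta')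
    have "AE x in N. \<forall>y\<in>Y. \<pi> y = 0 \<longrightarrow> p y x = 0"
      using finite_Y by (intro AE_finite_allI) (auto dest: p_eq_0_AE)
    then show "AE x in N. AE y in count_space Y.
        (\<lambda>(x, y). \<pi> y) (x, y) = 0 \<longrightarrow> (\<lambda>(x, y). p y x) (x, y) = 0"
      by (simp add: AE_count_space)
  qed
  have int_g: "integrable (N \<Otimes>\<^sub>M count_space Y) (\<lambda>(x, y). g y x)"
    by (rule NY'.integrable_const_bound[where B="1 + (\<Sum>y\<in>Y. \<bar>ln (\<pi> y)\<bar>)"])
       (auto intro!: AE_I2 pair_measurable g_bound g_meas simp: space_pair_measure)
  have joint: "distr J (S \<Otimes>\<^sub>M count_space Y) (\<lambda>z. (fst z, snd z)) = J"
    by (simp add: distr_id2 sets_J)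
  have "label_mutual_information S Y J =
      KL_divergence (exp 1) (density (N \<Otimes>\<^sub>M count_space Y) (\<lambda>z. ennreal ((\<lambda>(x, y). \<pi> y) z)))
        (density (N \<Otimes>\<^sub>M count_space Y) (\<lambda>z. ennreal ((\<lambda>(x, y). p y x) z)))"
    unfolding label_mutual_information_def J.mutual_information_def product_of_marginals joint
    by (simp add: case_prod_beta' J_eq_density[symmetric, unfolded case_prod_beta'])
  also have "\<dots> = (\<integral>z. (\<lambda>(x, y). p y x) z *
      log (exp 1) ((\<lambda>(x, y). p y x) z / (\<lambda>(x, y). \<pi> y) z) \<partial>(N \<Otimes>\<^sub>M count_space Y))"
    by (rule NY.P.KL_density_density)
       (use ac in \<open>auto intro!: pair_measurable AE_I2 simp: p_measurable space_pair_measure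
          p_nonneg label_prob_nonneg\<close>)
  also have "\<dots> = (\<integral>(x, y). g y x \<partial>(N \<Otimes>\<^sub>M count_space Y))"
    by (intro Bochner_Integration.integral_cong) (auto simp: g_def log_def)
  also have "\<dots> = (\<integral>x. (\<Sum>y\<in>Y. g y x) \<partial>N)"
    using NY.integral_fst'[OF int_g]
    by (simp add: lebesgue_integral_count_space_finite[OF finite_Y])
  also have "\<dots> = (\<integral>x. (\<Sum>y\<in>Y. p y x * ln (p y x) - p y x * ln (\<pi> y)) \<partial>N)"
  proof (rule integral_cong_AE)
    have "AE x in N. \<forall>y\<in>Y. g y x = p y x * ln (p y x) - p y x * ln (\<pi> y)"
      using finite_Y g_AE by (intro AE_finite_allI)
    then show "AE x in N. (\<Sum>y\<in>Y. g y x) = (\<Sum>y\<in>Y. p y x * ln (p y x) - p y x * ln (\<pi> y))"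
      by (rule AE_mp) (auto intro!: AE_I2 sum.cong)
  qed measurable
  also have "\<dots> = (\<integral>x. p_ln_p x \<partial>N) - (\<integral>x. (\<Sum>y\<in>Y. p y x * ln (\<pi> y)) \<partial>N)"
    by (simp only: sum_subtractf, rule Bochner_Integration.integral_diff)
       (auto intro!: Bochner_Integration.integrable_sum integrable_p_ln_p integrable_mult_left integrable_p)
  also have "(\<integral>x. (\<Sum>y\<in>Y. p y x * ln (\<pi> y)) \<partial>N) = (\<Sum>y\<in>Y. \<pi> y * ln (\<pi> y))"
    by (subst Bochner_Integration.integral_sum)
       (auto intro!: integrable_mult_left integrable_p sum.cong simp: integral_p)
  finally show ?thesis
    by (simp add: label_entropy_def)
qed

text \<open>The integrand is nonpositive, so only its negative part contributes, and disintegration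
  turns that into an integral over pairs. The right-hand side no longer mentions \<open>p\<close>,
  which permits the later change of variables.\<close>

lemma log_likelihood_eq:
  assumes F [measurable]: "F \<in> measurable S S'" and q: "label_kernel S' Y q"
  shows "ext_expectation N (\<lambda>x. \<Sum>y\<in>Y. ereal (p y x) * elog (q y (F x))) =
    - enn2ereal (\<integral>\<^sup>+(x, y). e2ennreal (- elog (q y (F x))) \<partial>J)"
proof -
  define L where "L x = (\<Sum>y\<in>Y. ennreal (p y x) * e2ennreal (- elog (q y (F x))))" for x
  have [measurable (raw)]: "(\<lambda>x. q y (F x)) \<in> borel_measurable S" if "y \<in> Y" for y
    using q that by (intro measurable_compose[OF F]) (simp add: label_kernel_def)
  have sum_eq: "(\<Sum>y\<in>Y. ereal (p y x) * elog (q y (F x))) = - enn2ereal (L x)"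
    if x: "x \<in> space S" for x
  proof -
    have Fx: "F x \<in> space S'" using measurable_space[OF F x] .
    have "(\<Sum>y\<in>Y. ereal (p y x) * elog (q y (F x))) =
        (\<Sum>y\<in>Y. - enn2ereal (ennreal (p y x) * e2ennreal (- elog (q y (F x)))))"
      using q p_nonneg[OF x] Fx label_kernel_le_1[OF finite_Y q Fx]
      by (intro sum.cong neg_mult_elog) (auto simp: label_kernel_def)
    also have "\<dots> = - (\<Sum>y\<in>Y. enn2ereal (ennreal (p y x) * e2ennreal (- elog (q y (F x)))))"
      by (rule sum_uminus_ereal) simp
    finally show ?thesis by (simp add: L_def)
  qed
  have "(\<integral>\<^sup>+x. e2ennreal (\<Sum>y\<in>Y. ereal (p y x) * elog (q y (F x))) \<partial>N) = (\<integral>\<^sup>+x. 0 \<partial>N)"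
    by (intro nn_integral_cong) (auto simp: sum_eq e2ennreal_neg)
  moreover have "(\<integral>\<^sup>+x. e2ennreal (- (\<Sum>y\<in>Y. ereal (p y x) * elog (q y (F x)))) \<partial>N) =
      (\<integral>\<^sup>+x. L x \<partial>N)"
    by (intro nn_integral_cong) (auto simp: sum_eq)
  moreover have "(\<integral>\<^sup>+x. L x \<partial>N) = (\<integral>\<^sup>+(x, y). e2ennreal (- elog (q y (F x))) \<partial>J)"
    unfolding L_def by (intro nn_integral_J[symmetric]) measurable
  ultimately show ?thesis
    by (simp add: ext_expectation_def zero_ennreal.rep_eq)
qed

lemma p_ln_p_nonpos: "x \<in> space S \<Longrightarrow> p_ln_p x \<le> 0"
  by (intro sum_nonpos mult_nonneg_nonpos) (auto simp: ln_nonpos_if_le_1 p_nonneg p_le_1)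

text \<open>Finiteness of the cross entropy excludes \<open>\<infinity> - \<infinity>\<close>.\<close>

lemma expected_KL_eq:
  assumes q: "label_kernel S Y q"
    and fin: "(\<integral>\<^sup>+(x, y). e2ennreal (- elog (q y x)) \<partial>J) = ennreal c" and "0 \<le> c"
  shows "ext_expectation N (pointwise_KL Y p q) = ereal ((\<integral>x. p_ln_p x \<partial>N) + c)"
proof -
  define L where "L x = (\<Sum>y\<in>Y. ennreal (p y x) * e2ennreal (- elog (q y x)))" for x
  have [measurable (raw)]: "q y \<in> borel_measurable S" if "y \<in> Y" for y
    using q that by (simp add: label_kernel_def)
  have [measurable]: "L \<in> borel_measurable S"
    unfolding L_def by measurable
  have L: "(\<integral>\<^sup>+x. L x \<partial>N) = ennreal c"
    unfolding L_def fin[symmetric] by (intro nn_integral_J[symmetric]) measurable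
  have KL: "pointwise_KL Y p q x = ereal (p_ln_p x) + enn2ereal (L x)" if "x \<in> space S" for x
    unfolding L_def by (rule pointwise_KL_eq[OF finite_Y kernel q that])
  note KL_nonneg = pointwise_KL_nonneg[OF kernel q]
  \<comment> \<open>With the nonpositive \<open>p_ln_p\<close> moved to the other side, all terms
    are nonnegative and additivity of the nonnegative integral applies.\<close>
  have add_eq: "e2ennreal (pointwise_KL Y p q x) + ennreal (- p_ln_p x) = L x"
    if x: "x \<in> space S" for x
  proof -
    have "enn2ereal (e2ennreal (pointwise_KL Y p q x) + ennreal (- p_ln_p x)) = enn2ereal (L x)"
      using KL_nonneg[OF x] p_ln_p_nonpos[OF x] KL[OF x]
      by (cases "enn2ereal (L x)") (simp_all add: plus_ennreal.rep_eq enn2ereal_e2ennreal)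
    then show ?thesis by (simp add: enn2ereal_inject)
  qed
  have int: "integrable N p_ln_p"
    by (intro Bochner_Integration.integrable_sum integrable_p_ln_p)
  \<comment> \<open>Measurability is shown for the decomposed form and carried over, since the two
    forms agree on the space.\<close>
  have "(\<lambda>x. e2ennreal (ereal (p_ln_p x) + enn2ereal (L x))) \<in> borel_measurable N"
    by measurable
  then have meas: "(\<lambda>x. e2ennreal (pointwise_KL Y p q x)) \<in> borel_measurable N"
    by (rule measurable_cong[THEN iffD1, rotated]) (simp add: KL)
  have h: "(\<integral>\<^sup>+x. ennreal (- p_ln_p x) \<partial>N) = ennreal (- (\<integral>x. p_ln_p x \<partial>N))"
    using int by (subst nn_integral_eq_integral) (auto intro!: AE_I2 p_ln_p_nonpos)
  have "0 \<le> (\<integral>x. - p_ln_p x \<partial>N)"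
    by (intro integral_nonneg_AE) (auto intro!: AE_I2 p_ln_p_nonpos)
  then have h_nonpos: "(\<integral>x. p_ln_p x \<partial>N) \<le> 0"
    by simp
  define K where "K = (\<integral>\<^sup>+x. e2ennreal (pointwise_KL Y p q x) \<partial>N)"
  have "K + ennreal (- (\<integral>x. p_ln_p x \<partial>N)) =
      (\<integral>\<^sup>+x. e2ennreal (pointwise_KL Y p q x) + ennreal (- p_ln_p x) \<partial>N)"
    unfolding K_def h[symmetric] using meas
    by (intro nn_integral_add[symmetric]) auto
  also have "\<dots> = ennreal c"
    unfolding L[symmetric] by (intro nn_integral_cong) (simp add: add_eq)
  finally have "enn2ereal (K + ennreal (- (\<integral>x. p_ln_p x \<partial>N))) = ereal c"
    using \<open>0 \<le> c\<close> by simp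
  \<comment> \<open>A sum with a finite value forces \<open>K\<close> to be finite, so the entropy
    term can be subtracted.\<close>
  then have "enn2ereal K = ereal ((\<integral>x. p_ln_p x \<partial>N) + c)"
    using h_nonpos by (cases "enn2ereal K") (simp_all add: plus_ennreal.rep_eq)
  \<comment> \<open>By Gibbs' inequality the negative part vanishes.\<close>
  moreover have "(\<integral>\<^sup>+x. e2ennreal (- pointwise_KL Y p q x) \<partial>N) = (\<integral>\<^sup>+x. 0 \<partial>N)"
    by (intro nn_integral_cong) (auto simp: e2ennreal_neg KL_nonneg)
  ultimately show ?thesis
    by (simp add: ext_expectation_def K_def zero_ennreal.rep_eq)
qed

end

section \<open>Measurability of the spectral filter\<close>

lemma complexify_measurable: "complexify H W \<in> measurable (real_images H W) (complex_images H W)"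
  unfolding complexify_def real_images_def complex_images_def
  by (rule measurable_restrict) measurable

lemma dft2_measurable: "dft2 H W \<in> measurable (complex_images H W) (complex_images H W)"
  unfolding dft2_def complex_images_def
  by (rule measurable_restrict) (auto simp: split_beta' intro!: borel_measurable_sum borel_measurable_times)

lemma idft2_measurable: "idft2 H W \<in> measurable (complex_images H W) (complex_images H W)"
  unfolding idft2_def complex_images_def
  by (rule measurable_restrict) (auto simp: split_beta' intro!: borel_measurable_sum borel_measurable_times)

text \<open>The filter is a composition of complexification, transform, an entrywise affine map and
  inverse transform, each measurable coordinate by coordinate.\<close>

lemma coalition_filter_measurable:
  "coalition_filter H W b \<C> \<in> measurable (real_images H W) (complex_images H W)"
proof -
  have "(\<lambda>f. \<lambda>k\<in>grid H W. f k * mask \<C> k + b k * (1 - mask \<C> k))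
      \<in> measurable (complex_images H W) (complex_images H W)"
    unfolding complex_images_def by (rule measurable_restrict) measurable
  from measurable_compose[OF measurable_compose[OF measurable_compose[OF complexify_measurable
        dft2_measurable] this] idft2_measurable]
  show ?thesis
    by (simp add: coalition_filter_def[abs_def])
qed

lemma coalition_filter_measurable_filtered:
  "coalition_filter H W b \<C> \<in> measurable (image_space H W X) (filtered_space H W b X \<C>)"
  unfolding image_space_def filtered_space_def
  by (rule measurable_restrict_space3[OF coalition_filter_measurable])
     (auto simp: filtered_images_def)

text \<open>Transfers the classifier from the set of all its inputs to the filtered images of one
  coalition.\<close>

lemma label_kernel_restrict_mono:
  assumes "label_kernel (restrict_space M A) Y q" "B \<subseteq> A"
  shows "label_kernel (restrict_space M B) Y q"
  using assms unfolding label_kernel_def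
  by (auto simp: space_restrict_space intro: measurable_restrict_mono)

section \<open>Mutual information between filtered images and labels\<close>

theorem theorem3p6:
  fixes H W M :: nat
    and X :: "(nat \<times> nat \<Rightarrow> real) set"
    and Y :: "'l set"
    and P :: "((nat \<times> nat \<Rightarrow> real) \<times> 'l) measure"
    and b :: "nat \<times> nat \<Rightarrow> complex"
    and band :: "nat \<Rightarrow> (nat \<times> nat) set"
    and Q :: "'l \<Rightarrow> (nat \<times> nat \<Rightarrow> complex) \<Rightarrow> real"
    and p :: "'l \<Rightarrow> (nat \<times> nat \<Rightarrow> real) \<Rightarrow> real"
    and p\<^sub>f :: "'l \<Rightarrow> (nat \<times> nat \<Rightarrow> complex) \<Rightarrow> real"
    and \<C> :: "(nat \<times> nat) set set"
  assumes images: "X \<subseteq> space (real_images H W)"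
    and labels: "finite Y"
    and law: "prob_space P" "sets P = sets (image_space H W X \<Otimes>\<^sub>M count_space Y)"
    and bands: "partition_on (grid H W) (spectral_players M band)" "inj_on band {..<M}"
    and classifier: "label_kernel
      (restrict_space (complex_images H W) (classifier_inputs H W b X (spectral_players M band))) Y Q"
    and conditional_original: "conditional_label_law (image_space H W X) Y P p"
    and finite_expectations: "\<And>\<D>. \<D> \<subseteq> spectral_players M band \<Longrightarrow>
      \<bar>expected_log_likelihood H W b X Y P p Q \<D>\<bar> \<noteq> \<infinity>"
    and coalition: "\<C> \<subseteq> spectral_players M band"
    and conditional_filtered:
      "conditional_label_law (filtered_space H W b X \<C>) Y (filtered_law H W b X Y P \<C>) p\<^sub>f"
  shows "ereal (label_mutual_information (filtered_space H W b X \<C>) Y (filtered_law H W b X Y P \<C>)) =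
      ext_expectation (distr (filtered_law H W b X Y P \<C>) (filtered_space H W b X \<C>) fst)
        (pointwise_KL Y p\<^sub>f Q)
      + ereal (label_entropy Y P)
      + characteristic_function H W b X Y P p Q \<C>
      + dummy_constant H W b X Y P p Q"
proof -
  define S where "S = image_space H W X"
  define S' where "S' = filtered_space H W b X \<C>"
  define J where "J = filtered_law H W b X Y P \<C>"
  let ?F = "coalition_filter H W b \<C>"
  let ?inputs = "classifier_inputs H W b X (spectral_players M band)"
  have F [measurable]: "?F \<in> measurable S S'"
    unfolding S_def S'_def by (rule coalition_filter_measurable_filtered)
  have sets_P [measurable_cong]: "sets P = sets (S \<Otimes>\<^sub>M count_space Y)"
    using law(2) unfolding S_def .
  have map [measurable]: "(\<lambda>(x, y). (?F x, y)) \<in> measurable P (S' \<Otimes>\<^sub>M count_space Y)"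
    by measurable
  have J_distr: "J = distr P (S' \<Otimes>\<^sub>M count_space Y) (\<lambda>(x, y). (?F x, y))"
    by (simp add: J_def S'_def filtered_law_def)
  interpret P: conditional_labels S Y P p
    using labels law sets_P conditional_original
    by (simp add: conditional_labels_def conditional_labels_axioms_def S_def)
  have "prob_space J"
    unfolding J_distr by (rule P.J.prob_space_distr[OF map])
  then interpret J: conditional_labels S' Y J p\<^sub>f
    using labels conditional_filtered
    by (simp add: conditional_labels_def conditional_labels_axioms_def J_distr)
       (simp add: S'_def flip: filtered_law_def)
  have Q: "label_kernel S' Y Q"
    unfolding S'_def filtered_space_def
    by (rule label_kernel_restrict_mono[OF classifier])
       (use coalition in \<open>auto simp: classifier_inputs_def\<close>)
  have [measurable (raw)]: "Q y \<in> borel_measurable S'" if "y \<in> Y" for y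
    using Q that by (simp add: label_kernel_def)
  \<comment> \<open>The cross entropy of the classifier under the filtered law.\<close>
  define L where "L = (\<integral>\<^sup>+(x, y). e2ennreal (- elog (Q y x)) \<partial>J)"
  \<comment> \<open>Change of variables back to the original images, where
    \<open>P.log_likelihood_eq\<close> identifies the integral with the negated
    log-likelihood.\<close>
  have "L = (\<integral>\<^sup>+(x, y). e2ennreal (- elog (Q y (?F x))) \<partial>P)"
    unfolding L_def J_distr
    by (subst nn_integral_distr[OF map])
       (auto intro!: measurable_pair_count_space countable_finite labels nn_integral_cong)
  then have likelihood: "expected_log_likelihood H W b X Y P p Q \<C> = - enn2ereal L"
    unfolding expected_log_likelihood_def S_def[symmetric]
    by (simp add: P.log_likelihood_eq[OF F Q])
  obtain c where c: "L = ennreal c" "0 \<le> c"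
    using finite_expectations[OF coalition] by (cases L) (auto simp: likelihood)
  \<comment> \<open>The constant belongs to the empty coalition, hence is finite, and therefore
    cancels in \<open>ereal\<close> when added to the characteristic function.\<close>
  obtain d where d: "dummy_constant H W b X Y P p Q = ereal d"
    using finite_expectations[of "{}"]
    by (cases "dummy_constant H W b X Y P p Q") (auto simp: dummy_constant_def)
  \<comment> \<open>Filtering leaves the label untouched, so the entropy under the filtered law is
    the one under \<open>P\<close>.\<close>
  have "label_prob J y = label_prob P y" for y
  proof -
    have "{z \<in> space J. snd z = y} = snd -` ({y} \<inter> Y) \<inter> space J"
      by (auto simp: J.space_J)
    also have "\<dots> \<in> sets J"
      by (rule measurable_sets[OF J.snd_measurable_J]) simp
    finally have "measure J {z \<in> space J. snd z = y} =
        measure P ((\<lambda>(x, y). (?F x, y)) -` {z \<in> space J. snd z = y} \<inter> space P)"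
      unfolding J_distr by (subst measure_distr[OF map]) simp_all
    also have "(\<lambda>(x, y). (?F x, y)) -` {z \<in> space J. snd z = y} \<inter> space P =
        {z \<in> space P. snd z = y}"
      using measurable_space[OF F] by (auto simp: J.space_J P.space_J)
    finally show ?thesis
      by (simp add: label_prob_def)
  qed
  then have entropy: "label_entropy Y J = label_entropy Y P"
    by (simp add: label_entropy_def)
  \<comment> \<open>All terms are now finite: the \<open>c\<close> in the expected divergence
    cancels against the log-likelihood \<open>- c\<close>.\<close>
  show ?thesis
    unfolding S'_def[symmetric] J_def[symmetric] characteristic_function_def likelihood d
    by (simp add: J.expected_KL_eq[OF Q c[unfolded L_def]] J.mutual_information_eq entropy c)
qed

end
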